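(* Let $A\in\mathbb{R}^{n\times n}$ be invertible. Let $D,E\in\mathbb{R}^{n\times n}$ be diagonal matrices with positive diagonal entries. Then $D$ and $E$ equilibrate $A$ with row and column norms one (i.e. every row and every column of $DAE$ has $\ell_2$-norm $1$) if and only if $(D,E)$ minimizes $\Phi(\tilde D A\tilde E)$ over all pairs $(\tilde D,\tilde E)$ of diagonal $n\times n$ matrices with positive diagonal entries.
   Context: For a nonsingular matrix $U\in\mathbb{R}^{n\times n}$ with singular values $\sigma_1\ge\cdots\ge\sigma_n>0$, the function $\Phi$ is defined by $$\Phi(U)=\frac{\exp\left(\|U\|_F^2/2\right)}{\det(U^TU)^{1/2}}=\frac{\exp\left(\sum_{i=1}^n\sigma_i^2/2\right)}{\prod_{i=1}^n\sigma_i},$$ where $\|\cdot\|_F$ is the Frobenius norm. *)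

theory Defs
  imports "HOL-Analysis.Analysis"
begin

definition pos_diagonal :: "real ^ 'n ^ 'n \<Rightarrow> bool" where
  "pos_diagonal D \<longleftrightarrow> (\<forall>i j. i \<noteq> j \<longrightarrow> D $ i $ j = 0) \<and> (\<forall>i. 0 < D $ i $ i)"

(* The library norm on real ^ 'n ^ 'n is the Euclidean norm of the vector of
   Euclidean row norms, i.e. the Frobenius norm. *)
lemma norm_matrix_eq_frobenius:
  fixes U :: "real ^ 'n ^ 'm"
  shows "norm U = sqrt (\<Sum>i\<in>UNIV. \<Sum>j\<in>UNIV. (U $ i $ j)\<^sup>2)"
  by (simp add: norm_vec_def L2_set_def sum_nonneg)

(* Meaningful for nonsingular U only: for singular U the denominator is 0 and
   the value is 0 by the convention x / 0 = 0. *)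
definition Phi :: "real ^ 'n ^ 'n \<Rightarrow> real" where
  "Phi U = exp ((norm U)\<^sup>2 / 2) / sqrt (det (transpose U ** U))"

definition unit_rows_columns :: "real ^ 'n ^ 'n \<Rightarrow> bool" where
  "unit_rows_columns M \<longleftrightarrow> (\<forall>i. norm (row i M) = 1) \<and> (\<forall>j. norm (column j M) = 1)"

end

theory Submission
  imports Defs
begin

text \<open>
  Writing \<open>U = P ** M ** Q\<close> for a positive diagonal rescaling of \<open>M = D ** A ** E\<close>,
  \<open>ln (Phi U)\<close> is half the sum of the \<open>p\<^sub>i\<^sup>2 m\<^sub>i\<^sub>j\<^sup>2 q\<^sub>j\<^sup>2\<close> minus the sum of all
  \<open>ln p\<^sub>i\<close> and \<open>ln q\<^sub>j\<close>, up to a constant. If the \<open>m\<^sub>i\<^sub>j\<^sup>2\<close> form a doubly stochastic matrix,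
  the inequality \<open>x \<ge> 1 + ln x\<close> applied to each \<open>(p\<^sub>i q\<^sub>j)\<^sup>2\<close> shows that \<open>M\<close> is minimal.
  Conversely, normalising a single row of squared norm \<open>r\<close> changes \<open>ln (Phi M)\<close> by
  \<open>(1 - r + ln r) / 2\<close>, which is negative unless \<open>r = 1\<close>; columns follow by transposition.
\<close>

lemma pos_diagonal_nth_matrix_mult:
  assumes "pos_diagonal P"
  shows "(P ** M) $ i $ j = P $ i $ i * M $ i $ j"
proof -
  have "(P ** M) $ i $ j = (\<Sum>k\<in>UNIV. if k = i then P $ i $ i * M $ i $ j else 0)"
    unfolding matrix_matrix_mult_def vec_lambda_beta
    using assms by (intro sum.cong) (auto simp: pos_diagonal_def)
  then show ?thesis by simp
qed

lemma matrix_mult_pos_diagonal_nth: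
  assumes "pos_diagonal Q"
  shows "(M ** Q) $ i $ j = M $ i $ j * Q $ j $ j"
proof -
  have "(M ** Q) $ i $ j = (\<Sum>k\<in>UNIV. if k = j then M $ i $ j * Q $ j $ j else 0)"
    unfolding matrix_matrix_mult_def vec_lambda_beta
    using assms by (intro sum.cong) (auto simp: pos_diagonal_def)
  then show ?thesis by simp
qed

lemma pos_diagonal_mult:
  assumes "pos_diagonal P" "pos_diagonal Q"
  shows "pos_diagonal (P ** Q)"
  using assms(2) assms(1)
  by (simp add: pos_diagonal_def[of "P ** Q"] pos_diagonal_nth_matrix_mult[OF assms(1)])
    (simp add: pos_diagonal_def)

lemma transpose_pos_diagonal:
  assumes "pos_diagonal P"
  shows "transpose P = P"
  using assms unfolding pos_diagonal_def transpose_def vec_eq_iff vec_lambda_beta by metis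

lemma det_pos_diagonal:
  assumes "pos_diagonal P"
  shows "det P = (\<Prod>i\<in>UNIV. P $ i $ i)"
  using assms by (intro det_diagonal) (auto simp: pos_diagonal_def)

lemma det_pos_diagonal_pos:
  assumes "pos_diagonal P"
  shows "det P > 0"
  using assms by (auto simp: det_pos_diagonal pos_diagonal_def intro!: prod_pos)

text \<open>Together with closure under products this makes the positive diagonal matrices a group,
  which lets minimality be transported between \<open>A\<close> and
  \<open>D ** A ** E\<close>.\<close>

lemma pos_diagonal_inverse:
  assumes "pos_diagonal D"
  obtains D' where "pos_diagonal D'" "D' ** D = mat 1" "D ** D' = mat 1"
proof
  let ?D' = "(\<chi> i j. if i = j then inverse (D $ i $ i) else 0) :: real ^ 'a ^ 'a"
  have nz: "D $ i $ i \<noteq> 0" for i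
    using assms unfolding pos_diagonal_def by (metis less_irrefl)
  show pos: "pos_diagonal ?D'"
    using assms by (auto simp: pos_diagonal_def)
  show "?D' ** D = mat 1"
    using assms nz
    by (auto simp: vec_eq_iff pos_diagonal_nth_matrix_mult[OF pos] mat_def pos_diagonal_def)
  show "D ** ?D' = mat 1"
    using assms nz
    by (auto simp: vec_eq_iff pos_diagonal_nth_matrix_mult[OF assms] mat_def pos_diagonal_def)
qed

lemma norm_matrix_squared:
  fixes U :: "real ^ 'n ^ 'm"
  shows "(norm U)\<^sup>2 = (\<Sum>i\<in>UNIV. \<Sum>j\<in>UNIV. (U $ i $ j)\<^sup>2)"
  unfolding norm_matrix_eq_frobenius by (intro real_sqrt_pow2 sum_nonneg) auto

lemma norm_transpose:
  fixes U :: "real ^ 'n ^ 'm"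
  shows "norm (transpose U) = norm U"
proof -
  have "(\<Sum>i\<in>UNIV. \<Sum>j\<in>UNIV. (U $ j $ i)\<^sup>2) = (\<Sum>j\<in>UNIV. \<Sum>i\<in>UNIV. (U $ j $ i)\<^sup>2)"
    by (rule sum.swap)
  then show ?thesis
    by (simp add: norm_matrix_eq_frobenius transpose_def)
qed

text \<open>The determinant under the root is the square of \<open>det U\<close>, whose sign is
  arbitrary; hence the absolute value.\<close>

lemma Phi_eq: "Phi U = exp ((norm U)\<^sup>2 / 2) / \<bar>det U\<bar>"
  by (simp add: Phi_def det_mul)

lemma Phi_transpose: "Phi (transpose U) = Phi U"
  by (simp add: Phi_eq norm_transpose)

text \<open>Taking logarithms turns the quotient into a difference, where a diagonal rescaling
  contributes additively to the determinant term.\<close>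

lemma Phi_le_iff:
  fixes U V :: "real ^ 'n ^ 'n"
  assumes "det U \<noteq> 0" "det V \<noteq> 0"
  shows "Phi U \<le> Phi V \<longleftrightarrow>
    (norm U)\<^sup>2 / 2 - ln \<bar>det U\<bar> \<le> (norm V)\<^sup>2 / 2 - ln \<bar>det V\<bar>"
proof -
  have "Phi W = exp ((norm W)\<^sup>2 / 2 - ln \<bar>det W\<bar>)" if "det W \<noteq> 0" for W :: "real ^ 'n ^ 'n"
    using that by (simp add: Phi_eq exp_diff)
  from this[OF assms(1)] this[OF assms(2)] show ?thesis by simp
qed

lemma norm_row_squared: "(norm (row i M))\<^sup>2 = (\<Sum>j\<in>UNIV. (M $ i $ j)\<^sup>2)"
  for M :: "real ^ 'n ^ 'm"
  by (simp add: norm_vec_def L2_set_def row_def sum_nonneg)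

lemma norm_column_squared: "(norm (column j M))\<^sup>2 = (\<Sum>i\<in>UNIV. (M $ i $ j)\<^sup>2)"
  for M :: "real ^ 'n ^ 'm"
  by (simp add: norm_vec_def L2_set_def column_def sum_nonneg)

lemma ln_det_pos_diagonal:
  assumes "pos_diagonal P"
  shows "ln (det P) = (\<Sum>i\<in>UNIV. ln (P $ i $ i))"
  unfolding det_pos_diagonal[OF assms]
  using assms by (intro ln_prod) (auto simp: pos_diagonal_def less_imp_neq[symmetric])

lemma Phi_le_rescaled:
  fixes M :: "real ^ 'n ^ 'n"
  assumes "det M \<noteq> 0" and unit: "unit_rows_columns M"
    and P: "pos_diagonal P" and Q: "pos_diagonal Q"
  shows "Phi M \<le> Phi (P ** M ** Q)"
proof -
  let ?p = "\<lambda>i. P $ i $ i" and ?q = "\<lambda>j. Q $ j $ j" and ?w = "\<lambda>i j. (M $ i $ j)\<^sup>2"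
  have pos: "?p i > 0" "?q i > 0" for i
    using P Q by (auto simp: pos_diagonal_def)
  have rows: "(\<Sum>j\<in>UNIV. ?w i j) = 1" for i
    using unit by (simp flip: norm_row_squared add: unit_rows_columns_def)
  have columns: "(\<Sum>i\<in>UNIV. ?w i j) = 1" for j
    using unit by (simp flip: norm_column_squared add: unit_rows_columns_def)
  \<comment> \<open>The bound is left split into a \<open>?p\<close> part and a \<open>?q\<close>
    part, since the first is to be summed along rows and the second along columns.\<close>
  have term_le: "?w i j + 2 * (?w i j * ln (?p i) + ?w i j * ln (?q j)) \<le> (?p i * M $ i $ j * ?q j)\<^sup>2"
    for i j
  proof -
    have "ln ((?p i * ?q j)\<^sup>2) \<le> (?p i * ?q j)\<^sup>2 - 1"
      using pos by (intro ln_le_minus_one) (simp add: less_imp_neq[symmetric])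
    then have "1 + 2 * (ln (?p i) + ln (?q j)) \<le> (?p i * ?q j)\<^sup>2"
      using pos by (simp add: ln_realpow ln_mult_pos)
    then have "?w i j * (1 + 2 * (ln (?p i) + ln (?q j))) \<le> ?w i j * (?p i * ?q j)\<^sup>2"
      by (intro mult_left_mono) auto
    then show ?thesis
      by (simp add: algebra_simps power_mult_distrib)
  qed
  \<comment> \<open>Unit row and column sums make the weights disappear, leaving exactly the
    logarithms of \<open>det P\<close> and \<open>det Q\<close>.\<close>
  have "(\<Sum>i\<in>UNIV. \<Sum>j\<in>UNIV. ?w i j * ln (?p i)) = (\<Sum>i\<in>UNIV. ln (?p i))"
    by (simp flip: sum_distrib_right add: rows)
  moreover have "(\<Sum>i\<in>UNIV. \<Sum>j\<in>UNIV. ?w i j * ln (?q j)) = (\<Sum>j\<in>UNIV. ln (?q j))"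
    by (subst sum.swap) (simp flip: sum_distrib_right add: columns)
  ultimately have "(norm M)\<^sup>2 + 2 * (ln (det P) + ln (det Q))
      = (\<Sum>i\<in>UNIV. \<Sum>j\<in>UNIV. ?w i j + 2 * (?w i j * ln (?p i) + ?w i j * ln (?q j)))"
    by (simp add: norm_matrix_squared sum.distrib ln_det_pos_diagonal P Q flip: sum_distrib_left)
  also have "\<dots> \<le> (norm (P ** M ** Q))\<^sup>2"
    unfolding norm_matrix_squared
      pos_diagonal_nth_matrix_mult[OF P] matrix_mult_pos_diagonal_nth[OF Q]
    by (intro sum_mono term_le)
  finally show ?thesis
    using assms(1) det_pos_diagonal_pos[OF P] det_pos_diagonal_pos[OF Q]
    by (simp add: Phi_le_iff det_mul abs_mult ln_mult_pos)
qed

lemma unit_rows_if_minimal: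
  fixes M :: "real ^ 'n ^ 'n"
  assumes "det M \<noteq> 0" and min: "\<And>P. pos_diagonal P \<Longrightarrow> Phi M \<le> Phi (P ** M)"
  shows "norm (row k M) = 1"
proof -
  define r where "r = (norm (row k M))\<^sup>2"
  \<comment> \<open>A zero row would force \<open>det M = 0\<close>; so \<open>r\<close> is positive
    and the scaling by \<open>1 / sqrt r\<close> below is admissible.\<close>
  have "row k M \<noteq> 0"
    using assms(1) det_zero_row(2) by blast
  then have r: "r > 0" by (simp add: r_def)
  define P :: "real ^ 'n ^ 'n" where
    "P = (\<chi> i j. if i = j then if i = k then 1 / sqrt r else 1 else 0)"
  have P: "pos_diagonal P"
    using r by (auto simp: P_def pos_diagonal_def)
  have detP: "det P = 1 / sqrt r"
    unfolding det_pos_diagonal[OF P] by (simp add: P_def)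
  have norms: "(norm U)\<^sup>2 = (\<Sum>i\<in>UNIV. (norm (row i U))\<^sup>2)" for U :: "real ^ 'n ^ 'n"
    by (simp add: norm_matrix_squared norm_row_squared)
  have "row i (P ** M) = P $ i $ i *\<^sub>R row i M" for i
    by (simp add: vec_eq_iff row_def pos_diagonal_nth_matrix_mult[OF P])
  then have rows: "(norm (row i (P ** M)))\<^sup>2 = (if i = k then 1 else (norm (row i M))\<^sup>2)" for i
    using r by (simp add: P_def power_mult_distrib power_divide flip: r_def)
  have "(norm M)\<^sup>2 = r + (\<Sum>i\<in>UNIV - {k}. (norm (row i M))\<^sup>2)"
    unfolding norms r_def by (simp add: sum.remove[of UNIV k])
  moreover have "(norm (P ** M))\<^sup>2 = 1 + (\<Sum>i\<in>UNIV - {k}. (norm (row i M))\<^sup>2)"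
    unfolding norms rows by (simp add: sum.remove[of UNIV k])
  moreover have "(norm M)\<^sup>2 / 2 - ln \<bar>det M\<bar> \<le> (norm (P ** M))\<^sup>2 / 2 - ln \<bar>det (P ** M)\<bar>"
    using min[OF P] assms(1) r by (subst (asm) Phi_le_iff) (auto simp: det_mul detP)
  moreover have "ln \<bar>det (P ** M)\<bar> = ln \<bar>det M\<bar> - ln r / 2"
    using r assms(1) by (simp add: det_mul detP abs_mult ln_div ln_sqrt)
  \<comment> \<open>The other rows cancel: row \<open>k\<close> contributes \<open>r / 2\<close>
    before scaling and \<open>1 / 2 + ln r / 2\<close> after it. This reverses the general bound
    \<open>ln r \<le> r - 1\<close>, in which equality holds only at \<open>r = 1\<close>.\<close>
  ultimately have "r - 1 \<le> ln r" by argo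
  with ln_le_minus_one[OF r] have "ln r = r - 1" by simp
  with r have "r = 1" by (rule ln_eq_minus_one)
  then show ?thesis by (simp add: r_def power2_eq_1_iff)
      (smt (verit) norm_ge_zero)
qed

text \<open>Here the competitors are rescalings of \<open>M\<close> itself, so taking one factor to
  be \<open>mat 1\<close> isolates the rows or the columns.\<close>

lemma unit_rows_columns_iff_minimal:
  fixes M :: "real ^ 'n ^ 'n"
  assumes "det M \<noteq> 0"
  shows "unit_rows_columns M \<longleftrightarrow>
    (\<forall>P Q. pos_diagonal P \<and> pos_diagonal Q \<longrightarrow> Phi M \<le> Phi (P ** M ** Q))"
proof (intro iffI allI impI)
  assume min: "\<forall>P Q. pos_diagonal P \<and> pos_diagonal Q \<longrightarrow> Phi M \<le> Phi (P ** M ** Q)"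
  have one: "pos_diagonal (mat 1 :: real ^ 'n ^ 'n)"
    by (simp add: pos_diagonal_def mat_def)
  have "norm (row i M) = 1" for i
    using assms min one by (intro unit_rows_if_minimal) (metis matrix_mul_rid)+
  moreover have "norm (row j (transpose M)) = 1" for j
  proof (rule unit_rows_if_minimal)
    fix P :: "real ^ 'n ^ 'n" assume P: "pos_diagonal P"
    \<comment> \<open>As \<open>P\<close> is symmetric, scaling the rows of
      \<open>transpose M\<close> amounts to scaling the columns of \<open>M\<close>, and
      \<open>Phi\<close> is invariant under transposition.\<close>
    have "Phi (P ** transpose M) = Phi (transpose (M ** P))"
      by (simp add: matrix_transpose_mul transpose_pos_diagonal[OF P])
    with min P one show "Phi (transpose M) \<le> Phi (P ** transpose M)"
      unfolding Phi_transpose by (metis matrix_mul_lid)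
  qed (simp add: assms)
  ultimately show "unit_rows_columns M"
    by (simp add: unit_rows_columns_def)
qed (use assms Phi_le_rescaled in blast)

theorem theorem2p1:
  fixes A D E :: "real ^ 'n ^ 'n"
  assumes "invertible A"
    and "pos_diagonal D"
    and "pos_diagonal E"
  shows "unit_rows_columns (D ** A ** E) \<longleftrightarrow>
    is_arg_min (\<lambda>(D', E'). Phi (D' ** A ** E'))
      (\<lambda>(D', E'). pos_diagonal D' \<and> pos_diagonal E') (D, E)"
proof -
  let ?M = "D ** A ** E"
  obtain D1 where D1: "pos_diagonal D1" "D1 ** D = mat 1"
    using pos_diagonal_inverse[OF assms(2)] by metis
  obtain E1 where E1: "pos_diagonal E1" "E ** E1 = mat 1"
    using pos_diagonal_inverse[OF assms(3)] by metis
  have "det ?M \<noteq> 0"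
    using assms det_pos_diagonal_pos[of D] det_pos_diagonal_pos[of E]
    by (simp add: det_mul invertible_det_nz)
  then have "unit_rows_columns ?M \<longleftrightarrow>
      (\<forall>P Q. pos_diagonal P \<and> pos_diagonal Q \<longrightarrow> Phi ?M \<le> Phi (P ** ?M ** Q))"
    by (rule unit_rows_columns_iff_minimal)
  \<comment> \<open>By the group property, \<open>(P, Q)\<close> and \<open>(P ** D, E ** Q)\<close>
    range over the same pairs, so rescalings of \<open>?M\<close> and of \<open>A\<close>
    coincide.\<close>
  also have "\<dots> \<longleftrightarrow>
      (\<forall>D' E'. pos_diagonal D' \<and> pos_diagonal E' \<longrightarrow> Phi ?M \<le> Phi (D' ** A ** E'))"
  proof (intro iffI allI impI)
    fix P Q :: "real ^ 'n ^ 'n"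
    assume "\<forall>D' E'. pos_diagonal D' \<and> pos_diagonal E' \<longrightarrow> Phi ?M \<le> Phi (D' ** A ** E')"
      and "pos_diagonal P \<and> pos_diagonal Q"
    then have "Phi ?M \<le> Phi ((P ** D) ** A ** (E ** Q))"
      using assms pos_diagonal_mult by blast
    then show "Phi ?M \<le> Phi (P ** ?M ** Q)"
      by (simp add: matrix_mul_assoc)
  next
    fix D' E' :: "real ^ 'n ^ 'n"
    assume min: "\<forall>P Q. pos_diagonal P \<and> pos_diagonal Q \<longrightarrow> Phi ?M \<le> Phi (P ** ?M ** Q)"
      and "pos_diagonal D' \<and> pos_diagonal E'"
    \<comment> \<open>The factors are chosen so that \<open>D1\<close> cancels \<open>D\<close> and
      \<open>E1\<close> cancels \<open>E\<close>, leaving \<open>D' ** A ** E'\<close>.\<close>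
    then have "Phi ?M \<le> Phi ((D' ** D1) ** ?M ** (E1 ** E'))"
      using D1 E1 pos_diagonal_mult by blast
    also have "(D' ** D1) ** ?M ** (E1 ** E') = D' ** (D1 ** D) ** A ** (E ** E1) ** E'"
      by (simp only: matrix_mul_assoc)
    finally show "Phi ?M \<le> Phi (D' ** A ** E')"
      by (simp add: D1 E1)
  qed
  also have "\<dots> \<longleftrightarrow> is_arg_min (\<lambda>(D', E'). Phi (D' ** A ** E'))
      (\<lambda>(D', E'). pos_diagonal D' \<and> pos_diagonal E') (D, E)"
    using assms by (auto simp: is_arg_min_linorder)
  finally show ?thesis .
qed

end
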